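(* Let $D$ be a non-square positive integer, let $a,b\in\mathbb{Z}$, and let $F_D^{(a,b)}=\{(x,y)\in\mathbb{Z}^2 : (x-a)^2-D(y-b)^2=1\}$. Set $$K:=|a|+\max\{|b|+1,\sqrt{1+Db^2}\}.$$ Then for any real number $\lambda\ge K$, $$Q_{F_D^{(a,b)}}(\lambda)=\bigcup_{i,j\in\{1,-1\}}\{(iu(x)+a,\,jv(x)+b)\in\mathbb{Z}^2 : x\in\mathbb{Z}_{\ge 0},\ x\le g(\lambda-ia-jb)\}.$$ Consequently, for any real number $\lambda\ge K$, $$\left|Q_{F_D^{(a,b)}}(\lambda)\right|=2+\sum_{i,j\in\{1,-1\}}\lfloor g(\lambda-ia-jb)\rfloor.$$
   Context: Let $D$ be a non-square positive integer. The fundamental solution $(\alpha,\beta)$ of the Pell equation $x^2-Dy^2=1$ is the solution in positive integers with the smallest value of $x+y\sqrt{D}$ among all positive integer solutions. Define $u:[0,\infty)\to[1,\infty)$ and $v:[0,\infty)\to[0,\infty)$ by $$u(x)=\tfrac12\left\{(\alpha+\beta\sqrt{D})^x+(\alpha-\beta\sqrt{D})^x\right\},\qquad v(x)=\tfrac{1}{2\sqrt{D}}\left\{(\alpha+\beta\sqrt{D})^x-(\alpha-\beta\sqrt{D})^x\right\}.$$ The function $f:[0,\infty)\to[1,\infty)$, $f=u+v$, is a strictly increasing bijection, and $g:=f^{-1}:[1,\infty)\to[0,\infty)$ denotes its inverse. For any set $G\subseteq\mathbb{Z}^2$ and real $\lambda>0$, $Q_G(\lambda):=\{(x,y)\in G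 : |x|+|y|\le\lambda\}$. $\lfloor\cdot\rfloor$ is the floor function and $|\cdot|$ applied to a set is its cardinality. *)

theory Defs
  imports "HOL-Analysis.Analysis" "HOL-Computational_Algebra.Nth_Powers"
begin

definition is_fundamental_pell_solution :: "nat \<Rightarrow> int \<times> int \<Rightarrow> bool" where
  "is_fundamental_pell_solution D = (\<lambda>(\<alpha>, \<beta>).
     \<alpha> > 0 \<and> \<beta> > 0 \<and> \<alpha>\<^sup>2 - int D * \<beta>\<^sup>2 = 1 \<and>
     (\<forall>x y :: int. x > 0 \<and> y > 0 \<and> x\<^sup>2 - int D * y\<^sup>2 = 1 \<longrightarrow>
        real_of_int \<alpha> + real_of_int \<beta> * sqrt (real D)
          \<le> real_of_int x + real_of_int y * sqrt (real D)))"

definition fundamental_pell_solution :: "nat \<Rightarrow> int \<times> int" where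
  "fundamental_pell_solution D = (THE p. is_fundamental_pell_solution D p)"

definition pell_alpha :: "nat \<Rightarrow> real" where
  "pell_alpha D = real_of_int (fst (fundamental_pell_solution D))"

definition pell_beta :: "nat \<Rightarrow> real" where
  "pell_beta D = real_of_int (snd (fundamental_pell_solution D))"

text \<open>The functions below are total on the reals; only their values on
  the nonnegative reals are meaningful (\<open>pell_g\<close>: on the reals \<open>\<ge> 1\<close>).
  Both bases of \<open>powr\<close> are positive when \<open>D\<close> is not a square, since their
  product is \<open>1\<close>.\<close>

definition pell_u :: "nat \<Rightarrow> real \<Rightarrow> real" where
  "pell_u D x = 1 / 2 *
     ((pell_alpha D + pell_beta D * sqrt (real D)) powr x
      + (pell_alpha D - pell_beta D * sqrt (real D)) powr x)"

definition pell_v :: "nat \<Rightarrow> real \<Rightarrow> real" where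
  "pell_v D x = 1 / (2 * sqrt (real D)) *
     ((pell_alpha D + pell_beta D * sqrt (real D)) powr x
      - (pell_alpha D - pell_beta D * sqrt (real D)) powr x)"

definition pell_f :: "nat \<Rightarrow> real \<Rightarrow> real" where
  "pell_f D x = pell_u D x + pell_v D x"

definition pell_g :: "nat \<Rightarrow> real \<Rightarrow> real" where
  "pell_g D = the_inv_into {0..} (pell_f D)"

definition Q :: "(int \<times> int) set \<Rightarrow> real \<Rightarrow> (int \<times> int) set" where
  "Q G r = {(x, y) \<in> G. real_of_int (\<bar>x\<bar> + \<bar>y\<bar>) \<le> r}"

definition F :: "nat \<Rightarrow> int \<Rightarrow> int \<Rightarrow> (int \<times> int) set" where
  "F D a b = {(x, y). (x - a)\<^sup>2 - int D * (y - b)\<^sup>2 = 1}"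

end

theory Submission
  imports Defs
begin

text \<open>Dirichlet approximation gives infinitely many pairs \<open>(p, q)\<close> with \<open>p\<^sup>2 - D q\<^sup>2\<close> bounded; two of
  them with equal norm \<open>N\<close> and congruent modulo \<open>N\<close> have a quotient that solves the Pell equation.
  Descent by the fundamental unit \<open>\<epsilon>\<close> shows that the nonnegative solutions are exactly the
  \<open>(u(n), v(n))\<close>. For such a point, \<open>\<bar>iu + a\<bar> + \<bar>jv + b\<bar> \<ge> u + v + ia + jb\<close>, with equality unless
  \<open>u + ia\<close> or \<open>v + jb\<close> is negative; in the latter cases the left-hand side is at most \<open>K\<close> anyway.
  In the count, a branch with floor \<open>m\<close> has \<open>m + 1\<close> parameters, and the parameter \<open>0\<close> yields the
  same point for \<open>j = 1\<close> and \<open>j = -1\<close>; hence the constant \<open>4 - 2\<close>.\<close>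

section \<open>Existence of a nontrivial Pell solution\<close>

text \<open>For \<open>q \<noteq> 0\<close>, divisibility of the squares makes \<open>q\<close>
  divide \<open>p\<close>, and the quotient would be a square root of \<open>D\<close>.\<close>

lemma pell_norm_eq_0D:
  fixes p q :: int
  assumes "\<not> is_square D" and eq: "p\<^sup>2 = int D * q\<^sup>2"
  shows "p = 0 \<and> q = 0"
proof (cases "q = 0")
  case False
  have "q\<^sup>2 dvd p\<^sup>2"
    using eq by simp
  then obtain k where "p = q * k"
    by (auto simp: pow_divides_pow_iff)
  with eq False have "int D = k\<^sup>2"
    by (simp add: power_mult_distrib mult.commute)
  then have "D = (nat \<bar>k\<bar>)\<^sup>2"
    by (metis nat_int nat_power_eq power2_abs abs_ge_zero)
  with assms show ?thesis
    by auto
qed (use eq in simp)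

lemma sqrt_nonsquare_irrational:
  assumes "\<not> is_square D"
  shows "sqrt (real D) \<notin> \<rat>"
proof
  assume "sqrt (real D) \<in> \<rat>"
  then obtain p q :: int where q: "q > 0" and "sqrt (real D) = of_int p / of_int q"
    by (meson Rats_cases')
  then have "of_int p = sqrt (real D) * of_int q"
    by (simp add: field_simps)
  then have "(of_int p :: real)\<^sup>2 = real D * (of_int q)\<^sup>2"
    by (simp add: power_mult_distrib)
  then have "real_of_int (p\<^sup>2) = real_of_int (int D * q\<^sup>2)"
    by simp
  then have "p\<^sup>2 = int D * q\<^sup>2"
    by (simp only: of_int_eq_iff)
  with pell_norm_eq_0D[OF assms] q show False
    by fastforce
qed

text \<open>Up to sign the norm is the product of \<open>sqrt D * q - p\<close>, which is below
  \<open>1/q\<close> in absolute value, and \<open>sqrt D * q + p\<close>, which is at most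
  \<open>2 * sqrt D * q + 1\<close>. The bound no longer depends on the pair, as the pigeonhole
  argument requires.\<close>

lemma approx_set_sqrt_norm_bound:
  assumes "(p, q) \<in> approx_set (sqrt (real D))"
  shows "\<bar>p\<^sup>2 - int D * q\<^sup>2\<bar> \<le> \<lceil>2 * sqrt (real D) + 1\<rceil>"
proof -
  let ?s = "sqrt (real D)"
  have q: "q > 0" and close: "\<bar>?s - of_int p / of_int q\<bar> < 1 / (of_int q)\<^sup>2"
    using assms by (auto simp: approx_set_def)
  moreover have "?s * of_int q - of_int p = of_int q * (?s - of_int p / of_int q)"
    using q by (simp add: field_simps)
  ultimately have "\<bar>?s * of_int q - of_int p\<bar> < of_int q * (1 / (of_int q)\<^sup>2)"
    using mult_strict_left_mono[OF close, of "of_int q"] q by (simp add: abs_mult)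
  with q have less: "\<bar>?s * of_int q - of_int p\<bar> < 1 / of_int q"
    by (simp add: power2_eq_square)
  have q1: "1 / real_of_int q \<le> 1"
    using q by simp
  have "\<bar>of_int p + ?s * of_int q\<bar> \<le> 2 * ?s * of_int q + 1"
  proof -
    have "?s * of_int q \<ge> 0"
      using q by simp
    then show ?thesis
      using less q1 unfolding mult.assoc by linarith
  qed
  moreover have "real_of_int \<bar>p\<^sup>2 - int D * q\<^sup>2\<bar> = \<bar>?s * of_int q - of_int p\<bar> * \<bar>of_int p + ?s * of_int q\<bar>"
    by (simp flip: abs_mult add: algebra_simps power2_eq_square abs_minus_commute)
  ultimately have "real_of_int \<bar>p\<^sup>2 - int D * q\<^sup>2\<bar> \<le> 1 / of_int q * (2 * ?s * of_int q + 1)"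
    using mult_mono[OF less_imp_le[OF less], of "\<bar>of_int p + ?s * of_int q\<bar>" "2 * ?s * of_int q + 1"] q
    by simp
  also have "\<dots> = 2 * ?s + 1 / of_int q"
    using q by (simp add: field_simps)
  finally have "real_of_int \<bar>p\<^sup>2 - int D * q\<^sup>2\<bar> \<le> 2 * ?s + 1"
    using q1 by linarith
  then show ?thesis
    by linarith
qed

text \<open>The solution is the quotient of \<open>p' + q' * sqrt D\<close> by
  \<open>p + q * sqrt D\<close>, that is, their product after conjugating the divisor, divided by
  \<open>N\<close>. The congruences make its coefficients integers, and distinctness of the pairs
  keeps it from being trivial.\<close>

lemma pell_solution_of_congruent_norms:
  fixes p q p' q' D N :: int
  assumes nm: "p\<^sup>2 - D * q\<^sup>2 = N" "p'\<^sup>2 - D * q'\<^sup>2 = N" and "N \<noteq> 0"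
    and p: "p mod N = p' mod N" and q: "q mod N = q' mod N"
    and pos: "q > 0" "q' > 0" and ne: "(p, q) \<noteq> (p', q')"
  obtains x y where "x\<^sup>2 - D * y\<^sup>2 = 1" "y \<noteq> 0"
proof -
  obtain s t where s: "p' = p + N * s" and t: "q' = q + N * t"
    using p q by (metis mod_eqE)
  \<comment> \<open>The coefficients of the quotient, with \<open>p' = p + N * s\<close> and
    \<open>q' = q + N * t\<close> substituted and the factor \<open>N\<close> cancelled.\<close>
  define x where "x = 1 + p * s - D * q * t"
  define y where "y = p * t - q * s"
  have x: "N * x = p * p' - D * q * q'"
    unfolding nm(1)[symmetric] x_def s t by (simp add: algebra_simps power2_eq_square)
  have y: "N * y = p * q' - q * p'"
    unfolding y_def s t by algebra
  have "N\<^sup>2 * (x\<^sup>2 - D * y\<^sup>2) = (N * x)\<^sup>2 - D * (N * y)\<^sup>2"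
    by (simp add: power_mult_distrib algebra_simps)
  also have "\<dots> = (p\<^sup>2 - D * q\<^sup>2) * (p'\<^sup>2 - D * q'\<^sup>2)"
    unfolding x y by algebra
  finally have "x\<^sup>2 - D * y\<^sup>2 = 1"
    using nm \<open>N \<noteq> 0\<close> by (simp add: power2_eq_square)
  moreover have "y \<noteq> 0"
  proof
    assume "y = 0"
    with y have pq: "p * q' = q * p'"
      by simp
    \<comment> \<open>Square \<open>p * q' = q * p'\<close> and replace \<open>p\<^sup>2\<close> and
      \<open>p'\<^sup>2\<close> by means of the norm equations; the terms with \<open>D\<close>
      cancel.\<close>
    have "q'\<^sup>2 * N = q\<^sup>2 * N"
      using pq nm by algebra
    with \<open>N \<noteq> 0\<close> pos have "q = q'"
      by simp
    with pq pos ne show False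
      by simp
  qed
  ultimately show thesis
    using that by blast
qed

lemma pell_solution_exists:
  assumes ns: "\<not> is_square D"
  obtains x y :: int where "x > 0" "y > 0" "x\<^sup>2 - int D * y\<^sup>2 = 1"
proof -
  let ?A = "approx_set (sqrt (real D))"
  define nm where "nm p q = p\<^sup>2 - int D * q\<^sup>2" for p q
  \<comment> \<open>Pairs with equal \<open>h\<close> have the same norm and agree modulo it, which
    is what the quotient construction asks for.\<close>
  define h where "h = (\<lambda>(p, q). (nm p q, p mod nm p q, q mod nm p q))"
  define C where "C = \<lceil>2 * sqrt (real D) + 1\<rceil>"
  have nm0: "nm p q \<noteq> 0" if "q > 0" for p q
    using pell_norm_eq_0D[OF ns, of p q] that by (auto simp: nm_def)
  have A: "q > 0" "\<bar>nm p q\<bar> \<le> C" if "(p, q) \<in> ?A" for p q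
    using approx_set_sqrt_norm_bound[OF that] that by (auto simp: nm_def C_def approx_set_def)
  \<comment> \<open>A residue is smaller in absolute value than its modulus, also for a negative
    norm, so \<open>C\<close> bounds all three entries of \<open>h\<close>. Modulus 0 has to be
    excluded, since \<open>m mod 0\<close> is \<open>m\<close>.\<close>
  have mod_bound: "\<bar>m mod n\<bar> \<le> C" if "\<bar>n\<bar> \<le> C" "n \<noteq> 0" for m n
    using abs_mod_less[of n m] that by linarith
  have "h z \<in> {-C..C} \<times> {-C..C} \<times> {-C..C}" if "z \<in> ?A" for z
  proof -
    obtain p q where z: "z = (p, q)"
      by (cases z)
    have nm: "\<bar>nm p q\<bar> \<le> C" "nm p q \<noteq> 0"
      using A[of p q] nm0[of q p] that z by auto
    from nm(1) mod_bound[OF nm, of p] mod_bound[OF nm, of q] show ?thesis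
      unfolding z h_def abs_le_iff by simp
  qed
  then have "h ` ?A \<subseteq> {-C..C} \<times> {-C..C} \<times> {-C..C}"
    by blast
  then have "finite (h ` ?A)"
    by (rule finite_subset) simp
  moreover have "infinite ?A"
    using sqrt_nonsquare_irrational[OF ns] rational_iff_finite_approx_set by blast
  ultimately obtain z where z: "z \<in> ?A" and inf: "infinite {w \<in> ?A. h w = h z}"
    using pigeonhole_infinite by blast
  have "infinite ({w \<in> ?A. h w = h z} - {z})"
    using inf by simp
  then have "{w \<in> ?A. h w = h z} - {z} \<noteq> {}"
    by (rule infinite_imp_nonempty)
  then obtain w where w: "w \<in> ?A" "h w = h z" "w \<noteq> z"
    by blast
  obtain p q p' q' where zw: "z = (p, q)" "w = (p', q')"
    by (metis surj_pair)
  have eqs: "nm p' q' = nm p q" "p mod nm p q = p' mod nm p q" "q mod nm p q = q' mod nm p q"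
    using w(2) by (auto simp: zw h_def)
  have pos: "q > 0" "q' > 0"
    using A(1) z w(1) zw by auto
  obtain x y where xy: "x\<^sup>2 - int D * y\<^sup>2 = 1" "y \<noteq> 0"
  proof (rule pell_solution_of_congruent_norms[of p "int D" q "nm p q" p' q'])
    show "p\<^sup>2 - int D * q\<^sup>2 = nm p q" "p'\<^sup>2 - int D * q'\<^sup>2 = nm p q"
      using eqs(1) by (auto simp: nm_def)
    show "nm p q \<noteq> 0"
      by (rule nm0[OF pos(1)])
    show "(p, q) \<noteq> (p', q')"
      using w(3) zw by auto
  qed (use eqs pos in auto)
  have "x \<noteq> 0"
  proof
    assume "x = 0"
    with xy(1) have "int D * y\<^sup>2 = -1"
      by simp
    moreover have "int D * y\<^sup>2 \<ge> 0"
      by simp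
    ultimately show False
      by linarith
  qed
  show thesis
  proof (rule that)
    show "\<bar>x\<bar> > 0" "\<bar>y\<bar> > 0"
      using \<open>x \<noteq> 0\<close> xy(2) by simp_all
    show "\<bar>x\<bar>\<^sup>2 - int D * \<bar>y\<bar>\<^sup>2 = 1"
      using xy(1) by (simp only: power2_abs)
  qed
qed

section \<open>The fundamental solution\<close>

lemma pell_solution_mono:
  fixes x y x' y' :: int
  assumes "x\<^sup>2 - D * y\<^sup>2 = 1" "x'\<^sup>2 - D * y'\<^sup>2 = 1" "D > 0" "0 \<le> x" "x \<le> x'" "0 \<le> y'"
  shows "y \<le> y'"
proof -
  have "x\<^sup>2 \<le> x'\<^sup>2"
    using assms by (simp add: power_mono)
  then have "D * y\<^sup>2 \<le> D * y'\<^sup>2"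
    using assms(1,2) by linarith
  then have "y\<^sup>2 \<le> y'\<^sup>2"
    using \<open>D > 0\<close> by simp
  then show ?thesis
    using \<open>0 \<le> y'\<close> by (rule power2_le_imp_le)
qed

text \<open>Minimising the integer \<open>x\<close> avoids minimising over reals: the solution with
  least \<open>x\<close> also has least \<open>y\<close>, hence the least value of
  \<open>x + y * sqrt D\<close>.\<close>

lemma fundamental_pell_solution_exists:
  assumes ns: "\<not> is_square D" and D: "D > 0"
  shows "\<exists>p. is_fundamental_pell_solution D p"
proof -
  define P where "P n \<longleftrightarrow> n > 0 \<and> (\<exists>y>0. (int n)\<^sup>2 - int D * y\<^sup>2 = 1)" for n
  obtain x y :: int where "x > 0" "y > 0" "x\<^sup>2 - int D * y\<^sup>2 = 1"
    using pell_solution_exists[OF ns] .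
  then have "P (nat x)"
    by (auto simp: P_def)
  define n where "n = (LEAST n. P n)"
  have "P n"
    unfolding n_def using \<open>P (nat x)\<close> by (rule LeastI)
  then obtain \<beta> where \<beta>: "n > 0" "\<beta> > 0" "(int n)\<^sup>2 - int D * \<beta>\<^sup>2 = 1"
    by (auto simp: P_def)
  have "real_of_int (int n) + real_of_int \<beta> * sqrt (real D)
          \<le> real_of_int x + real_of_int y * sqrt (real D)"
    if xy: "x > 0" "y > 0" "x\<^sup>2 - int D * y\<^sup>2 = 1" for x y
  proof -
    have "P (nat x)"
      using xy by (auto simp: P_def)
    then have "n \<le> nat x"
      unfolding n_def by (rule Least_le)
    with xy have "int n \<le> x"
      by simp
    moreover from this have "\<beta> \<le> y"
      using pell_solution_mono[OF \<beta>(3) xy(3)] D xy by simp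
    ultimately show ?thesis
      by (intro add_mono mult_right_mono) auto
  qed
  with \<beta> have "is_fundamental_pell_solution D (int n, \<beta>)"
    by (simp add: is_fundamental_pell_solution_def)
  then show ?thesis ..
qed

text \<open>Two minimal solutions have the same value \<open>x + y * sqrt D\<close>; squaring the
  difference gives a vanishing norm, so the coordinates agree. This makes the \<open>THE\<close> in
  the definition meaningful.\<close>

lemma fundamental_pell_solution_unique:
  assumes ns: "\<not> is_square D"
    and "is_fundamental_pell_solution D p" "is_fundamental_pell_solution D q"
  shows "p = q"
proof -
  obtain x y x' y' where pq: "p = (x, y)" "q = (x', y')"
    by (cases p, cases q) blast
  have "real_of_int x + real_of_int y * sqrt (real D) = real_of_int x' + real_of_int y' * sqrt (real D)"
    using assms(2,3) unfolding pq is_fundamental_pell_solution_def prod.case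
    by (intro antisym) blast+
  then have "real_of_int (x - x') = real_of_int (y' - y) * sqrt (real D)"
    by (simp add: algebra_simps)
  then have "(real_of_int (x - x'))\<^sup>2 = (real_of_int (y' - y))\<^sup>2 * real D"
    by (simp add: power_mult_distrib)
  then have "real_of_int ((x - x')\<^sup>2) = real_of_int (int D * (y' - y)\<^sup>2)"
    by simp
  then have "(x - x')\<^sup>2 = int D * (y' - y)\<^sup>2"
    by (simp only: of_int_eq_iff)
  from pell_norm_eq_0D[OF ns this] show ?thesis
    by (simp add: pq)
qed

section \<open>Powers of the fundamental unit\<close>

locale nonsquare =
  fixes D :: nat
  assumes nonsquare: "\<not> is_square D" and D_pos: "D > 0"
begin

text \<open>Integer counterparts of \<open>pell_alpha\<close> and \<open>pell_beta\<close>, so that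
  identities between solutions can be proved over the integers.\<close>

definition \<alpha> :: int where "\<alpha> = fst (fundamental_pell_solution D)"
definition \<beta> :: int where "\<beta> = snd (fundamental_pell_solution D)"
definition \<epsilon> :: real where "\<epsilon> = of_int \<alpha> + of_int \<beta> * sqrt (real D)"

lemma fundamental: "is_fundamental_pell_solution D (\<alpha>, \<beta>)"
  unfolding \<alpha>_def \<beta>_def prod.collapse fundamental_pell_solution_def
  using fundamental_pell_solution_exists[OF nonsquare D_pos]
    fundamental_pell_solution_unique[OF nonsquare]
  by (metis theI')

lemma fund_sol: "\<alpha> > 0" "\<beta> > 0" "\<alpha>\<^sup>2 - int D * \<beta>\<^sup>2 = 1"
  using fundamental by (auto simp: is_fundamental_pell_solution_def)

text \<open>If \<open>y < \<beta>\<close>, then monotonicity gives \<open>x < \<alpha>\<close> as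
  well, and \<open>x + y * sqrt D\<close> would fall below \<open>\<epsilon>\<close>. The descent
  needs minimality in this form.\<close>

lemma \<beta>_le:
  assumes "x > 0" "y > 0" "x\<^sup>2 - int D * y\<^sup>2 = 1"
  shows "\<beta> \<le> y"
proof (rule ccontr)
  assume "\<not> \<beta> \<le> y"
  then have "x < \<alpha>"
    using pell_solution_mono[OF fund_sol(3) assms(3)] D_pos fund_sol assms by force
  moreover have "real_of_int y * sqrt (real D) \<le> real_of_int \<beta> * sqrt (real D)"
    using \<open>\<not> \<beta> \<le> y\<close> by (intro mult_right_mono) auto
  moreover have "\<epsilon> \<le> real_of_int x + real_of_int y * sqrt (real D)"
    using fundamental assms by (simp add: is_fundamental_pell_solution_def \<epsilon>_def)
  ultimately show False
    by (simp add: \<epsilon>_def)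
qed

lemma conj_times_\<epsilon>: "(of_int \<alpha> - of_int \<beta> * sqrt (real D)) * \<epsilon> = 1"
proof -
  have "(of_int \<alpha> - of_int \<beta> * sqrt (real D)) * \<epsilon> = real_of_int (\<alpha>\<^sup>2 - int D * \<beta>\<^sup>2)"
    by (simp add: \<epsilon>_def algebra_simps power2_eq_square)
  then show ?thesis
    by (simp add: fund_sol(3))
qed

lemma \<epsilon>_gt_1: "\<epsilon> > 1"
proof -
  have "real_of_int \<beta> * sqrt (real D) > 0" "real_of_int \<alpha> \<ge> 1"
    using fund_sol D_pos by auto
  then show ?thesis
    by (simp add: \<epsilon>_def)
qed

lemma conj_eq_inverse: "of_int \<alpha> - of_int \<beta> * sqrt (real D) = inverse \<epsilon>"
  using conj_times_\<epsilon> \<epsilon>_gt_1 by (metis inverse_unique mult.commute)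

text \<open>Multiplication by \<open>\<epsilon>\<close> composes solutions (Brahmagupta's identity).
  The conjugate power is carried along because \<open>u\<close> and \<open>v\<close> combine both
  powers.\<close>

lemma solution_of_power:
  "\<exists>x y :: int. x > 0 \<and> y \<ge> 0 \<and> x\<^sup>2 - int D * y\<^sup>2 = 1 \<and>
     \<epsilon> ^ n = of_int x + of_int y * sqrt (real D) \<and>
     inverse \<epsilon> ^ n = of_int x - of_int y * sqrt (real D)"
proof (induction n)
  case 0
  show ?case
    by (rule exI[of _ 1], rule exI[of _ 0]) simp
next
  case (Suc n)
  then obtain x y :: int where xy: "x > 0" "y \<ge> 0" "x\<^sup>2 - int D * y\<^sup>2 = 1"
    and pow: "\<epsilon> ^ n = of_int x + of_int y * sqrt (real D)"
      "inverse \<epsilon> ^ n = of_int x - of_int y * sqrt (real D)"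
    by blast
  let ?x = "\<alpha> * x + int D * \<beta> * y" and ?y = "\<alpha> * y + \<beta> * x"
  have "?x > 0" "?y \<ge> 0"
    using fund_sol xy by (simp_all add: add_pos_nonneg)
  moreover have "?x\<^sup>2 - int D * ?y\<^sup>2 = 1"
    using fund_sol(3) xy(3) by algebra
  moreover have "\<epsilon> ^ Suc n = of_int ?x + of_int ?y * sqrt (real D)"
    unfolding power_Suc pow by (simp add: \<epsilon>_def algebra_simps)
  moreover have "inverse \<epsilon> ^ Suc n = (of_int \<alpha> - of_int \<beta> * sqrt (real D)) * inverse \<epsilon> ^ n"
    by (simp add: conj_eq_inverse)
  then have "inverse \<epsilon> ^ Suc n = of_int ?x - of_int ?y * sqrt (real D)"
    unfolding pow(2) by (simp add: algebra_simps)
  ultimately show ?case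
    by blast
qed

text \<open>Descent on \<open>y\<close>: dividing by \<open>\<epsilon>\<close> yields a solution
  with positive \<open>x\<close>, nonnegative \<open>y\<close> and strictly smaller
  \<open>y\<close>, until \<open>(1, 0)\<close> is reached. Each inequality is proved by comparing
  squares.\<close>

lemma power_of_solution:
  fixes x y :: int
  assumes "x > 0" "y \<ge> 0" "x\<^sup>2 - int D * y\<^sup>2 = 1"
  shows "\<exists>n. \<epsilon> ^ n = of_int x + of_int y * sqrt (real D)"
  using assms
proof (induction "nat y" arbitrary: x y rule: less_induct)
  case less
  note xy = less.prems
  show ?case
  proof (cases "y = 0")
    case True
    with xy have "x = 1"
      by (simp add: power2_eq_1_iff)
    with True show ?thesis
      by (intro exI[of _ 0]) simp
  next
    case False
    \<comment> \<open>The coordinates of \<open>(x + y * sqrt D) / \<epsilon>\<close>.\<close>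
    let ?x = "\<alpha> * x - int D * \<beta> * y" and ?y = "\<alpha> * y - \<beta> * x"
    have y: "y > 0"
      using False xy by simp
    have D: "int D > 0" using D_pos by simp
    have "(int D * \<beta> * y)\<^sup>2 < (\<alpha> * x)\<^sup>2"
    proof -
      have "(\<alpha> * x)\<^sup>2 = (1 + int D * \<beta>\<^sup>2) * (1 + int D * y\<^sup>2)"
        using fund_sol(3) xy(3) by algebra
      also have "\<dots> = 1 + int D * \<beta>\<^sup>2 + int D * y\<^sup>2 + (int D * \<beta> * y)\<^sup>2"
        by algebra
      finally show ?thesis
        by (simp add: add_pos_nonneg)
    qed
    then have "int D * \<beta> * y < \<alpha> * x"
      by (rule power2_less_imp_less) (use fund_sol(1) xy(1) in simp)
    then have x': "?x > 0"
      by simp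
    \<comment> \<open>By the norm equations the difference of the two squares is
      \<open>y\<^sup>2 - \<beta>\<^sup>2\<close>, so minimality of \<open>\<beta>\<close> is exactly
      what keeps \<open>?y\<close> nonnegative.\<close>
    have "(\<beta> * x)\<^sup>2 \<le> (\<alpha> * y)\<^sup>2"
    proof -
      have "\<beta>\<^sup>2 \<le> y\<^sup>2"
        using \<beta>_le[OF xy(1) y xy(3)] fund_sol(2) by (simp add: power_mono)
      moreover have "(\<alpha> * y)\<^sup>2 - (\<beta> * x)\<^sup>2 = y\<^sup>2 - \<beta>\<^sup>2"
        using fund_sol(3) xy(3) by algebra
      ultimately show ?thesis
        by linarith
    qed
    then have "\<beta> * x \<le> \<alpha> * y"
      by (rule power2_le_imp_le) (use fund_sol(1) y in simp)
    then have y': "?y \<ge> 0"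
      by simp
    \<comment> \<open>This is \<open>?y < y\<close> rearranged and squared, the strict decrease that
      drives the induction.\<close>
    have "((\<alpha> - 1) * y)\<^sup>2 < (\<beta> * x)\<^sup>2"
    proof -
      have "(\<beta> * x)\<^sup>2 - ((\<alpha> - 1) * y)\<^sup>2 = \<beta>\<^sup>2 + 2 * (\<alpha> - 1) * y\<^sup>2"
        using fund_sol(3) xy(3) by algebra
      moreover have "\<beta>\<^sup>2 + 2 * (\<alpha> - 1) * y\<^sup>2 > 0"
        using fund_sol by (intro add_pos_nonneg) auto
      ultimately show ?thesis
        by linarith
    qed
    then have "(\<alpha> - 1) * y < \<beta> * x"
      by (rule power2_less_imp_less) (use fund_sol(2) xy(1) in simp)
    then have "?y < y"
      by (simp add: algebra_simps)
    then have "nat ?y < nat y"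
      using y by simp
    moreover have "?x\<^sup>2 - int D * ?y\<^sup>2 = 1"
      using fund_sol(3) xy(3) by algebra
    ultimately obtain n where n: "\<epsilon> ^ n = of_int ?x + of_int ?y * sqrt (real D)"
      using less.hyps x' y' by blast
    have inv: "inverse \<epsilon> * (of_int x + of_int y * sqrt (real D)) = of_int ?x + of_int ?y * sqrt (real D)"
      by (simp add: algebra_simps flip: conj_eq_inverse)
    have "\<epsilon> ^ Suc n = \<epsilon> * inverse \<epsilon> * (of_int x + of_int y * sqrt (real D))"
      by (simp only: power_Suc n inv mult.assoc)
    then have "\<epsilon> ^ Suc n = of_int x + of_int y * sqrt (real D)"
      using \<epsilon>_gt_1 by simp
    then show ?thesis ..
  qed
qed


section \<open>The functions u, v, f and the inverse g\<close>

text \<open>The conjugate of \<open>\<epsilon>\<close> is its inverse, so \<open>u\<close> and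
  \<open>sqrt D * v\<close> are the hyperbolic cosine and sine of
  \<open>x * ln \<epsilon>\<close>.\<close>

lemma pell_u_eq: "pell_u D x = (\<epsilon> powr x + inverse (\<epsilon> powr x)) / 2"
  and pell_v_eq: "pell_v D x = (\<epsilon> powr x - inverse (\<epsilon> powr x)) / (2 * sqrt (real D))"
proof -
  have "inverse \<epsilon> powr x = inverse (\<epsilon> powr x)"
    using \<epsilon>_gt_1 by (simp add: inverse_powr)
  then show "pell_u D x = (\<epsilon> powr x + inverse (\<epsilon> powr x)) / 2"
    and "pell_v D x = (\<epsilon> powr x - inverse (\<epsilon> powr x)) / (2 * sqrt (real D))"
    unfolding pell_u_def pell_v_def pell_alpha_def pell_beta_def
      \<alpha>_def[symmetric] \<beta>_def[symmetric] \<epsilon>_def[symmetric] conj_eq_inverse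
    by simp_all
qed

lemma pell_uv_0: "pell_u D 0 = 1" "pell_v D 0 = 0"
  using \<epsilon>_gt_1 by (simp_all add: pell_u_eq pell_v_eq)

lemma pell_u_mono:
  assumes "0 \<le> x" "x \<le> y"
  shows "pell_u D x \<le> pell_u D y"
proof -
  define s t where "s = \<epsilon> powr x" and "t = \<epsilon> powr y"
  have st: "1 \<le> s" "s \<le> t"
    using assms \<epsilon>_gt_1 by (simp_all add: s_def t_def ge_one_powr_ge_zero)
  \<comment> \<open>This factorisation shows that \<open>t + 1/t\<close> increases for
    \<open>t \<ge> 1\<close>.\<close>
  have "t + inverse t - (s + inverse s) = (t - s) * (1 - inverse (s * t))"
    using st by (simp add: field_simps)
  also have "\<dots> \<ge> 0"
  proof (intro mult_nonneg_nonneg)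
    have "s * t \<ge> 1"
      using mult_mono[of 1 s 1 t] st by simp
    then show "0 \<le> 1 - inverse (s * t)"
      using le_imp_inverse_le[of 1 "s * t"] by simp
  qed (use st in simp)
  finally show ?thesis
    by (simp add: pell_u_eq s_def t_def)
qed

lemma pell_v_strict_mono:
  assumes "x < y"
  shows "pell_v D x < pell_v D y"
proof -
  have "\<epsilon> powr x < \<epsilon> powr y" "\<epsilon> powr x > 0"
    using assms \<epsilon>_gt_1 by simp_all
  then have "\<epsilon> powr x - inverse (\<epsilon> powr x) < \<epsilon> powr y - inverse (\<epsilon> powr y)"
    by (intro diff_strict_mono less_imp_inverse_less)
  then show ?thesis
    using D_pos by (simp add: pell_v_eq divide_strict_right_mono)
qed

lemma pell_f_strict_mono: "strict_mono_on {0..} (pell_f D)"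
  by (intro strict_mono_onI)
    (simp add: pell_f_def add_le_less_mono pell_u_mono pell_v_strict_mono)

lemma pell_f_surj:
  assumes "y \<ge> 1"
  obtains x where "x \<ge> 0" "pell_f D x = y"
proof -
  \<comment> \<open>With this right endpoint for the intermediate value theorem, half of
    \<open>\<epsilon> powr z\<close> is already \<open>y\<close>, hence
    \<open>u(z) \<ge> y\<close>.\<close>
  define z where "z = log \<epsilon> (2 * y)"
  have z: "z \<ge> 0" "\<epsilon> powr z = 2 * y"
    using assms \<epsilon>_gt_1 by (simp_all add: z_def)
  have "pell_v D z \<ge> 0"
    using pell_v_strict_mono[of 0 z] z(1) pell_uv_0 by (cases "z = 0") auto
  moreover have "y \<le> pell_u D z"
    using z(2) assms by (simp add: pell_u_eq)
  ultimately have "y \<le> pell_f D z"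
    by (simp add: pell_f_def)
  moreover have "pell_f D 0 \<le> y"
    using assms by (simp add: pell_f_def pell_uv_0)
  moreover have "continuous_on {0..z} (pell_f D)"
    unfolding pell_f_def pell_u_eq pell_v_eq
    using \<epsilon>_gt_1 D_pos by (intro continuous_intros) auto
  ultimately show thesis
    using IVT'[of "pell_f D" 0 y z] z(1) that by auto
qed

lemma pell_g:
  assumes "y \<ge> 1"
  shows "pell_g D y \<ge> 0" "pell_f D (pell_g D y) = y"
proof -
  obtain x where "x \<ge> 0" "pell_f D x = y"
    using pell_f_surj[OF assms] .
  moreover from this have "pell_g D y = x"
    using the_inv_into_f_f[OF strict_mono_on_imp_inj_on[OF pell_f_strict_mono], of x]
    by (auto simp: pell_g_def)
  ultimately show "pell_g D y \<ge> 0" "pell_f D (pell_g D y) = y"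
    by simp_all
qed

text \<open>Translates the parameter range, stated through \<open>g\<close>, into a bound on
  \<open>u + v\<close>.\<close>

lemma le_pell_g_iff:
  assumes "x \<ge> 0" "y \<ge> 1"
  shows "x \<le> pell_g D y \<longleftrightarrow> pell_f D x \<le> y"
  using strict_mono_on_leD[OF pell_f_strict_mono, of x "pell_g D y"]
    strict_mono_onD[OF pell_f_strict_mono, of "pell_g D y" x] pell_g[OF assms(2)] assms(1)
  by (auto simp: not_le[symmetric])

text \<open>\<open>\<epsilon> ^ n\<close> and its inverse are conjugate, so their half-sum and
  scaled half-difference are the integer coordinates.\<close>

lemma pell_uv_nat:
  obtains x y :: int where "x > 0" "y \<ge> 0" "x\<^sup>2 - int D * y\<^sup>2 = 1"
    "pell_u D (real n) = of_int x" "pell_v D (real n) = of_int y"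
proof -
  obtain x y :: int where xy: "x > 0" "y \<ge> 0" "x\<^sup>2 - int D * y\<^sup>2 = 1"
    and pow: "\<epsilon> ^ n = of_int x + of_int y * sqrt (real D)"
      "inverse \<epsilon> ^ n = of_int x - of_int y * sqrt (real D)"
    using solution_of_power by blast
  have powr: "\<epsilon> powr real n = \<epsilon> ^ n"
    using \<epsilon>_gt_1 by (simp add: powr_realpow)
  have inv: "inverse (of_int x + of_int y * sqrt (real D)) = of_int x - of_int y * sqrt (real D)"
    using pow by (simp add: power_inverse)
  have "pell_u D (real n) = of_int x" "pell_v D (real n) = of_int y"
    using D_pos unfolding pell_u_eq pell_v_eq powr pow(1) inv by simp_all
  with xy show thesis
    by (rule that)
qed

lemma pell_solution_eq_uv:
  fixes x y :: int
  assumes "x > 0" "y \<ge> 0" "x\<^sup>2 - int D * y\<^sup>2 = 1"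
  obtains n :: nat where "pell_u D (real n) = of_int x" "pell_v D (real n) = of_int y"
proof -
  obtain n where n: "\<epsilon> ^ n = of_int x + of_int y * sqrt (real D)"
    using power_of_solution[OF assms] by blast
  have "(of_int x + of_int y * sqrt (real D)) * (of_int x - of_int y * sqrt (real D))
      = real_of_int (x\<^sup>2 - int D * y\<^sup>2)"
    by (simp add: algebra_simps power2_eq_square)
  then have "\<epsilon> ^ n * (of_int x - of_int y * sqrt (real D)) = 1"
    using n assms(3) by simp
  then have inv: "inverse (of_int x + of_int y * sqrt (real D)) = of_int x - of_int y * sqrt (real D)"
    unfolding n by (rule inverse_unique)
  have powr: "\<epsilon> powr real n = \<epsilon> ^ n"
    using \<epsilon>_gt_1 by (simp add: powr_realpow)
  have "pell_u D (real n) = of_int x" "pell_v D (real n) = of_int y"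
    using D_pos unfolding pell_u_eq pell_v_eq powr n inv by simp_all
  then show thesis
    by (rule that)
qed

end

section \<open>Absolute values on a shifted branch of the hyperbola\<close>

text \<open>On \<open>[0, c]\<close> the convex function \<open>v \<mapsto> sqrt (1 + d v\<^sup>2) - v\<close> is maximal at an endpoint.\<close>

lemma hyperbola_endpoint_bound:
  fixes c d v :: real
  assumes "d \<ge> 1" "0 \<le> v" "v \<le> c"
  shows "sqrt (1 + d * v\<^sup>2) - v \<le> max 1 (sqrt (1 + d * c\<^sup>2) - c)"
proof (cases "c = 0")
  case False
  with assms have c: "c > 0"
    by simp
  define M where "M = max 1 (sqrt (1 + d * c\<^sup>2) - c)"
  have M: "M \<ge> 1" "sqrt (1 + d * c\<^sup>2) \<le> c + M"
    by (auto simp: M_def)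
  from M(2) have "1 + d * c\<^sup>2 \<le> (c + M)\<^sup>2"
    by (rule sqrt_le_D)
  then have end_c: "(d - 1) * c\<^sup>2 \<le> M\<^sup>2 - 1 + 2 * c * M"
    by (simp add: power2_eq_square algebra_simps)
  \<comment> \<open>After squaring, the goal is \<open>end_c\<close> with \<open>v\<close> in place
    of \<open>c\<close>. Multiply \<open>end_c\<close> by \<open>v\<close> and use
    \<open>v \<le> c\<close> and \<open>M \<ge> 1\<close>; the common factor \<open>c\<close>
    cancels at the end.\<close>
  have "(d - 1) * v\<^sup>2 * c \<le> (d - 1) * (v * c) * c"
    using assms by (intro mult_right_mono mult_left_mono) (auto simp: power2_eq_square mult_left_mono)
  also have "\<dots> = v * ((d - 1) * c\<^sup>2)"
    by (simp add: power2_eq_square)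
  also have "\<dots> \<le> v * (M\<^sup>2 - 1 + 2 * c * M)"
    using end_c assms by (intro mult_left_mono)
  also have "\<dots> \<le> c * (M\<^sup>2 - 1) + v * (2 * c * M)"
    unfolding distrib_left using assms M(1) by (intro add_right_mono mult_right_mono) auto
  also have "\<dots> = (M\<^sup>2 - 1 + 2 * v * M) * c"
    by (simp add: algebra_simps)
  finally have "(d - 1) * v\<^sup>2 \<le> M\<^sup>2 - 1 + 2 * v * M"
    using c by simp
  then have "1 + d * v\<^sup>2 \<le> (v + M)\<^sup>2"
    by (simp add: power2_eq_square algebra_simps)
  then have "sqrt (1 + d * v\<^sup>2) \<le> v + M"
    using assms M by (intro real_le_lsqrt) auto
  then show ?thesis
    unfolding M_def by linarith
qed (use assms in simp)

lemma abs_shifted_branch_le_iff: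
  fixes i j a b u v d r :: real
  assumes ij: "i \<in> {1, -1}" "j \<in> {1, -1}" and d: "d \<ge> 1"
    and uv: "u > 0" "v \<ge> 0" "u\<^sup>2 - d * v\<^sup>2 = 1"
    and r: "r \<ge> \<bar>a\<bar> + max (\<bar>b\<bar> + 1) (sqrt (1 + d * b\<^sup>2))"
  shows "\<bar>i * u + a\<bar> + \<bar>j * v + b\<bar> \<le> r \<longleftrightarrow> u + v \<le> r - i * a - j * b"
proof -
  have abs: "\<bar>i * u + a\<bar> = \<bar>u + i * a\<bar>" "\<bar>j * v + b\<bar> = \<bar>v + j * b\<bar>"
    "\<bar>i * a\<bar> = \<bar>a\<bar>" "\<bar>j * b\<bar> = \<bar>b\<bar>"
    using ij by auto
  have "v\<^sup>2 \<le> u\<^sup>2"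
    using uv(3) mult_right_mono[OF d, of "v\<^sup>2"] by simp
  then have vu: "v \<le> u"
    using uv(1) by (simp add: power2_le_iff_abs_le abs_le_iff)
  have u: "u = sqrt (1 + d * v\<^sup>2)"
    using uv by (intro real_sqrt_unique[symmetric]) auto
  \<comment> \<open>Here \<open>v < \<bar>b\<bar>\<close>, and the endpoint bound with
    \<open>c = \<bar>b\<bar>\<close> applies. Its two endpoint values, shifted by
    \<open>\<bar>b\<bar>\<close>, are the two terms of the maximum in \<open>K\<close>.\<close>
  have neg: "u - v + \<bar>b\<bar> \<le> r - \<bar>a\<bar>" if "v + j * b < 0"
  proof -
    have "v \<le> \<bar>b\<bar>"
      using that abs(4) by linarith
    from hyperbola_endpoint_bound[OF d uv(2) this] r show ?thesis
      unfolding u[symmetric] by auto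
  qed
  have r1: "\<bar>a\<bar> + \<bar>b\<bar> + 1 \<le> r"
    using r by simp
  have bounds: "-\<bar>a\<bar> \<le> i * a" "-\<bar>b\<bar> \<le> j * b" "j * b \<le> \<bar>b\<bar>" "i * a \<le> \<bar>a\<bar>"
    using abs(3,4) by linarith+
  have "\<bar>u + i * a\<bar> + \<bar>v + j * b\<bar> \<le> r" if le: "u + v \<le> r - i * a - j * b"
  proof (cases "v + j * b < 0")
    case True
    have "\<bar>u + i * a\<bar> \<le> u + \<bar>a\<bar>" "\<bar>v + j * b\<bar> \<le> \<bar>b\<bar> - v"
      using True uv(1) bounds by linarith+
    with neg[OF True] show ?thesis
      by linarith
  next
    case False
    show ?thesis
    proof (cases "u + i * a < 0")
      \<comment> \<open>The sum is at most \<open>\<bar>a\<bar> - u + v + \<bar>b\<bar>\<close>, and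
        \<open>v \<le> u\<close> reduces this to
        \<open>\<bar>a\<bar> + \<bar>b\<bar>\<close>.\<close>
      case True
      then have "\<bar>u + i * a\<bar> \<le> \<bar>a\<bar> - u"
        using bounds by linarith
      with False bounds vu r1 show ?thesis
        by linarith
    qed (use False le in linarith)
  qed
  then show ?thesis
    unfolding abs(1,2) by linarith
qed

section \<open>The description of the truncated solution set\<close>

context nonsquare
begin

lemma Q_F_eq:
  fixes a b :: int and r :: real
  assumes r: "r \<ge> real_of_int \<bar>a\<bar>
               + max (real_of_int (\<bar>b\<bar> + 1)) (sqrt (1 + real D * (real_of_int b)\<^sup>2))"
  shows "Q (F D a b) r =
           (\<Union>i\<in>{1, -1 :: int}. \<Union>j\<in>{1, -1 :: int}.
              {(p, q). \<exists>x :: nat.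
                 real x \<le> pell_g D (r - real_of_int (i * a) - real_of_int (j * b)) \<and>
                 real_of_int p = real_of_int i * pell_u D (real x) + real_of_int a \<and>
                 real_of_int q = real_of_int j * pell_v D (real x) + real_of_int b})"
    (is "_ = ?R")
proof -
  \<comment> \<open>From \<open>r \<ge> \<bar>a\<bar> + \<bar>b\<bar> + 1\<close>: every argument of
    \<open>g\<close> lies in its domain.\<close>
  have arg: "1 \<le> r - real_of_int (i * a) - real_of_int (j * b)"
    if "i \<in> {1, -1}" "j \<in> {1, -1}" for i j
    using r that by auto
  \<comment> \<open>Serves both inclusions: on each branch the parameter range is the size
    condition.\<close>
  have bound: "real x \<le> pell_g D (r - real_of_int (i * a) - real_of_int (j * b)) \<longleftrightarrow>
      real_of_int (\<bar>p\<bar> + \<bar>q\<bar>) \<le> r"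
    if ij: "i \<in> {1, -1}" "j \<in> {1, -1}"
      and p: "real_of_int p = real_of_int i * pell_u D (real x) + real_of_int a"
      and q: "real_of_int q = real_of_int j * pell_v D (real x) + real_of_int b"
    for i j p q x
  proof -
    obtain m n :: int where mn: "m > 0" "n \<ge> 0" "m\<^sup>2 - int D * n\<^sup>2 = 1"
      and uv: "pell_u D (real x) = of_int m" "pell_v D (real x) = of_int n"
      by (rule pell_uv_nat)
    have "real_of_int (m\<^sup>2 - int D * n\<^sup>2) = 1"
      using mn(3) by simp
    then have "(of_int m)\<^sup>2 - real D * (of_int n)\<^sup>2 = 1"
      by simp
    with mn r ij D_pos
    have "\<bar>of_int i * real_of_int m + of_int a\<bar> + \<bar>of_int j * of_int n + of_int b\<bar> \<le> r \<longleftrightarrow>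
        of_int m + of_int n \<le> r - of_int i * of_int a - of_int j * of_int b"
      by (intro abs_shifted_branch_le_iff[where d = "real D"]) auto
    then show ?thesis
      unfolding le_pell_g_iff[OF of_nat_0_le_iff arg[OF ij]]
      by (simp add: pell_f_def uv p q)
  qed
  show ?thesis
  proof (intro equalityI subsetI)
    fix z assume "z \<in> Q (F D a b) r"
    then obtain p q where z: "z = (p, q)" and nm: "(p - a)\<^sup>2 - int D * (q - b)\<^sup>2 = 1"
      and le: "real_of_int (\<bar>p\<bar> + \<bar>q\<bar>) \<le> r"
      by (auto simp: Q_def F_def)
    \<comment> \<open>The signs of \<open>p - a\<close> and \<open>q - b\<close>. For
      \<open>q = b\<close> either \<open>j\<close> would do, and 1 is the default.\<close>
    define i j :: int where "i = (if p < a then -1 else 1)" and "j = (if q < b then -1 else 1)"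
    have ij: "i \<in> {1, -1}" "j \<in> {1, -1}" "p = i * \<bar>p - a\<bar> + a" "q = j * \<bar>q - b\<bar> + b"
      by (auto simp: i_def j_def)
    have "int D * (q - b)\<^sup>2 \<ge> 0"
      by simp
    with nm have "p \<noteq> a"
      by (intro notI) simp
    then obtain x :: nat where "pell_u D (real x) = of_int \<bar>p - a\<bar>" "pell_v D (real x) = of_int \<bar>q - b\<bar>"
      using nm by (elim pell_solution_eq_uv[of "\<bar>p - a\<bar>" "\<bar>q - b\<bar>", rotated -1]) auto
    then have pq: "real_of_int p = real_of_int i * pell_u D (real x) + real_of_int a"
      "real_of_int q = real_of_int j * pell_v D (real x) + real_of_int b"
      using ij(3,4) by (metis of_int_add of_int_mult)+
    show "z \<in> ?R"
      unfolding z using bound[OF ij(1,2) pq] le pq ij(1,2) by blast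
  next
    fix z assume "z \<in> ?R"
    then obtain i j p q x where z: "z = (p, q)" and ij: "i \<in> {1, -1}" "j \<in> {1, -1}"
      and le: "real x \<le> pell_g D (r - real_of_int (i * a) - real_of_int (j * b))"
      and p: "real_of_int p = real_of_int i * pell_u D (real x) + real_of_int a"
      and q: "real_of_int q = real_of_int j * pell_v D (real x) + real_of_int b"
      by blast
    obtain m n :: int where mn: "m\<^sup>2 - int D * n\<^sup>2 = 1"
      and uv: "pell_u D (real x) = of_int m" "pell_v D (real x) = of_int n"
      by (rule pell_uv_nat)
    have "real_of_int p = real_of_int (i * m + a)" "real_of_int q = real_of_int (j * n + b)"
      using p q uv by simp_all
    then have "p = i * m + a" "q = j * n + b"
      by (simp_all only: of_int_eq_iff)
    then have "p - a = i * m" "q - b = j * n"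
      by simp_all
    moreover have "i\<^sup>2 = 1" "j\<^sup>2 = 1"
      using ij by auto
    ultimately have "(p - a)\<^sup>2 - int D * (q - b)\<^sup>2 = 1"
      using mn by (simp add: power_mult_distrib)
    then show "z \<in> Q (F D a b) r"
      using bound[OF ij p q] le by (simp add: z Q_def F_def)
  qed
qed

section \<open>Counting the points\<close>

lemma card_signed_shifted_solutions:
  fixes a b :: int and G :: "int \<Rightarrow> int \<Rightarrow> real"
  assumes G: "\<And>i j. i \<in> {1, -1} \<Longrightarrow> j \<in> {1, -1} \<Longrightarrow> G i j \<ge> 0"
  shows "int (card (\<Union>i\<in>{1, -1 :: int}. \<Union>j\<in>{1, -1 :: int}.
              {(p, q). \<exists>x :: nat. real x \<le> G i j \<and>
                 real_of_int p = real_of_int i * pell_u D (real x) + real_of_int a \<and>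
                 real_of_int q = real_of_int j * pell_v D (real x) + real_of_int b}))
         = 2 + (\<Sum>i\<in>{1, -1 :: int}. \<Sum>j\<in>{1, -1 :: int}. \<lfloor>G i j\<rfloor>)"
    (is "int (card ?R) = _")
proof -
  let ?I = "{1, -1 :: int} \<times> {1, -1 :: int}"
  \<comment> \<open>\<open>u\<close> and \<open>v\<close> are integers at natural arguments, so the
    floors only change the type.\<close>
  define X where "X n = \<lfloor>pell_u D (real n)\<rfloor>" for n :: nat
  define Y where "Y n = \<lfloor>pell_v D (real n)\<rfloor>" for n :: nat
  have X: "pell_u D (real n) = of_int (X n)" "X n > 0" for n
    by (rule pell_uv_nat[of n], simp add: X_def)+
  have Y: "pell_v D (real n) = of_int (Y n)" for n
    by (rule pell_uv_nat[of n], simp add: Y_def)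
  have Y_less: "Y m < Y n" if "m < n" for m n
    using pell_v_strict_mono[of "real m" "real n"] that by (simp add: Y)
  have XY_0: "X 0 = 1" "Y 0 = 0"
    by (simp_all add: X_def Y_def pell_uv_0)
  have Y_pos: "Y n > 0" if "n > 0" for n
    using Y_less[OF that] by (simp add: XY_0)
  have Y_inj: "m = n" if "Y m = Y n" for m n
    using Y_less[of m n] Y_less[of n m] that by (cases m n rule: linorder_cases) auto
  define pt where "pt = (\<lambda>((i, j), n). (i * X n + a, j * Y n + b))"
  define N where "N = (\<lambda>(i, j). nat \<lfloor>G i j\<rfloor>)"
  have le_G: "real n \<le> G i j \<longleftrightarrow> n \<le> N (i, j)" if "i \<in> {1, -1}" "j \<in> {1, -1}" for n i j
    using G[OF that] by (simp add: N_def le_nat_iff le_floor_iff)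
  have "?R = pt ` (SIGMA ij:?I. {0..N ij})"
  proof -
    have "{(p, q). \<exists>x :: nat. real x \<le> G i j \<and>
              real_of_int p = real_of_int i * pell_u D (real x) + real_of_int a \<and>
              real_of_int q = real_of_int j * pell_v D (real x) + real_of_int b}
        = (\<lambda>n. pt ((i, j), n)) ` {0..N (i, j)}" (is "?L = _")
      if ij: "i \<in> {1, -1}" "j \<in> {1, -1}" for i j
    proof -
      have "real_of_int p = real_of_int i * pell_u D (real x) + real_of_int a \<longleftrightarrow> p = i * X x + a"
        "real_of_int q = real_of_int j * pell_v D (real x) + real_of_int b \<longleftrightarrow> q = j * Y x + b" for p q x
        unfolding X Y by (simp_all flip: of_int_mult of_int_add)
      then show ?thesis
        by (auto simp: pt_def le_G[OF ij])
    qed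
    then show ?thesis
      by (auto simp: image_iff)
  qed
  \<comment> \<open>Parameter 0 is split off: there \<open>v = 0\<close>, the sign \<open>j\<close>
    is lost, and four index pairs give two points. The positive parameters of a branch number
    exactly the floor of its bound.\<close>
  also have "(SIGMA ij:?I. {0..N ij}) = ?I \<times> {0} \<union> (SIGMA ij:?I. {1..N ij})"
    by force
  also have "pt ` \<dots> = pt ` (?I \<times> {0}) \<union> pt ` (SIGMA ij:?I. {1..N ij})"
    by (rule image_Un)
  also have "pt ` (?I \<times> {0}) = {(1 + a, b), (-1 + a, b)}"
    by (auto simp: pt_def XY_0 image_iff)
  finally have R: "?R = {(1 + a, b), (-1 + a, b)} \<union> pt ` (SIGMA ij:?I. {1..N ij})" .
  have inj: "inj_on pt (SIGMA ij:?I. {1..N ij})"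
  proof (rule inj_onI)
    fix z z' assume "z \<in> (SIGMA ij:?I. {1..N ij})" "z' \<in> (SIGMA ij:?I. {1..N ij})" and "pt z = pt z'"
    moreover obtain i j n i' j' n' where z: "z = ((i, j), n)" "z' = ((i', j'), n')"
      by (metis surj_pair)
    ultimately have ij: "(i, j) \<in> ?I" "(i', j') \<in> ?I" and n: "n > 0" "n' > 0"
      and eq: "pt ((i, j), n) = pt ((i', j'), n')"
      by auto
    have "i * X n = i' * X n'" "j * Y n = j' * Y n'"
      using eq by (auto simp: pt_def)
    \<comment> \<open>\<open>X\<close> and \<open>Y\<close> are positive at positive parameters, so
      the signs of the two products determine \<open>i\<close> and \<open>j\<close>.\<close>
    with ij n X(2)[of n] X(2)[of n'] Y_pos[of n] Y_pos[of n']
    have "i = i'" "j = j'" "Y n = Y n'"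
      by auto
    with Y_inj show "z = z'"
      by (simp add: z)
  qed
  \<comment> \<open>The second coordinate separates the two parts: it equals \<open>b\<close> only
    for parameter 0.\<close>
  have snd_neq: "snd (pt z) \<noteq> b" if "z \<in> (SIGMA ij:?I. {1..N ij})" for z
  proof -
    obtain i j n where z: "z = ((i, j), n)"
      by (metis surj_pair)
    with that have "j \<noteq> 0" "n > 0"
      by auto
    with Y_pos[of n] show ?thesis
      by (simp add: pt_def z)
  qed
  have "{(1 + a, b), (-1 + a, b)} \<inter> pt ` (SIGMA ij:?I. {1..N ij}) = {}"
  proof (rule equals0I, elim IntE imageE)
    fix w z assume w: "w \<in> {(1 + a, b), (-1 + a, b)}" "w = pt z" and z: "z \<in> (SIGMA ij:?I. {1..N ij})"
    from w(1) have "snd w = b"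
      by auto
    with snd_neq[OF z] show False
      unfolding w(2) by (rule notE)
  qed
  moreover have "finite (pt ` (SIGMA ij:?I. {1..N ij}))"
    by (intro finite_imageI finite_SigmaI) auto
  ultimately have "card ?R = card {(1 + a, b), (-1 + a, b)} + card (pt ` (SIGMA ij:?I. {1..N ij}))"
    unfolding R by (intro card_Un_disjoint) simp_all
  also have "card {(1 + a, b), (-1 + a, b)} = 2"
    by simp
  also have "card (pt ` (SIGMA ij:?I. {1..N ij})) = (\<Sum>ij\<in>?I. N ij)"
    unfolding card_image[OF inj] by (subst card_SigmaI) auto
  finally have "int (card ?R) = 2 + (\<Sum>ij\<in>?I. int (N ij))"
    by (simp only: of_nat_add of_nat_sum of_nat_numeral)
  also have "(\<Sum>ij\<in>?I. int (N ij)) = (\<Sum>(i, j)\<in>?I. \<lfloor>G i j\<rfloor>)"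
    using G by (intro sum.cong) (auto simp: N_def)
  also have "\<dots> = (\<Sum>i\<in>{1, -1 :: int}. \<Sum>j\<in>{1, -1 :: int}. \<lfloor>G i j\<rfloor>)"
    by (rule sum.cartesian_product[symmetric])
  finally show ?thesis .
qed

end

theorem theorem3p3:
  fixes D :: nat and a b :: int and r :: real
  assumes "D > 0" and "\<not> is_square D"
    and "r \<ge> real_of_int \<bar>a\<bar>
               + max (real_of_int (\<bar>b\<bar> + 1)) (sqrt (1 + real D * (real_of_int b)\<^sup>2))"
  shows "Q (F D a b) r =
           (\<Union>i\<in>{1, -1 :: int}. \<Union>j\<in>{1, -1 :: int}.
              {(p, q). \<exists>x :: nat.
                 real x \<le> pell_g D (r - real_of_int (i * a) - real_of_int (j * b)) \<and>
                 real_of_int p = real_of_int i * pell_u D (real x) + real_of_int a \<and>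
                 real_of_int q = real_of_int j * pell_v D (real x) + real_of_int b})
         \<and>
         int (card (Q (F D a b) r)) =
           2 + (\<Sum>i\<in>{1, -1 :: int}. \<Sum>j\<in>{1, -1 :: int}.
                  \<lfloor>pell_g D (r - real_of_int (i * a) - real_of_int (j * b))\<rfloor>)"
proof -
  interpret nonsquare D
    by unfold_locales (use assms in auto)
  have "pell_g D (r - real_of_int (i * a) - real_of_int (j * b)) \<ge> 0"
    if "i \<in> {1, -1}" "j \<in> {1, -1}" for i j
    by (rule pell_g(1)) (use assms(3) that in auto)
  note card = card_signed_shifted_solutions
    [of "\<lambda>i j. pell_g D (r - real_of_int (i * a) - real_of_int (j * b))", OF this]
  show ?thesis
    unfolding Q_F_eq[OF assms(3)] by (intro conjI refl card)
qed

end
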